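(* Let $\Phi(\bar i, c, \bar o)$ be a quantifier-free formula of the theory $\mathcal{T}_U$ of uninterpreted functions and equality, where $\bar i$ and $\bar o$ are vectors of variables and $c$ is a Boolean variable, and suppose that $\forall \bar i\, \exists c\, \forall \bar o.\ \Phi(\bar i, c, \bar o)$ is valid. Let $\bar o_{\bot}$ and $\bar o_{\top}$ be two disjoint fresh copies of $\bar o$, put $A := \neg\Phi(\bar i, \bot, \bar o_{\bot})$ and $B := \neg\Phi(\bar i, \top, \bar o_{\top})$ (so $A \wedge B$ is unsatisfiable), and let $I$ be a Craig interpolant between $A$ and $B$. Then $I$ is a witness function for $c$, i.e. $\forall \bar i\, \forall \bar o.\ \Phi(\bar i, I, \bar o)$ is valid in $\mathcal{T}_U$.
   Context: Formulas of $\mathcal{T}_U$ are built from variables of an uninterpreted domain, Boolean variables, uninterpreted function symbols and uninterpreted predicate symbols by means of equality atoms $t=t$, predicate atoms, negation and disjunction. $\top$ and $\bot$ denote true and false. For a formula $\varphi$, $Symb(\varphi)$ is the set of variables, function symbols and predicate symbols occurring in $\varphi$, and $\varphi \preceq \psi$ means $Symb(\varphi)\subseteq Symb(\psi)$. A Craig interpolant between formulas $A$ and $B$ with $A\wedge B$ unsatisfiable is a formula $I$ with $I\preceq A$, $I \preceq B$, $A \Rightarrow I$ and $B \Rightarrow \neg I$ valid in $\mathcal{T}_U$. Since the $\bar o$-copies occur in only one of $A$, $B$, the interpolant $I$ is a formula in the variables $\bar i$ (together with shared function and predicate symbols), written $I = I(\bar i)$; $\Phi(\bar i, I, \bar o)$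 denotes the result of substituting $I(\bar i)$ for $c$. *)

theory Defs
  imports Main
begin

text \<open>
  Function and predicate symbols are identified by their name together with the number of
  arguments they are applied to, so every formula of type \<open>fm\<close> is well-formed over the
  signature of all pairs (name, arity).
\<close>

datatype 'v var = is_dom: DVar (name: 'v) | BVar (name: 'v)

datatype ('f, 'v) trm = Var 'v | Fun 'f "('f, 'v) trm list"

datatype ('f, 'p, 'v) fm =
    Top
  | Bot
  | BoolVar 'v
  | Eq "('f, 'v) trm" "('f, 'v) trm"
  | Pred 'p "('f, 'v) trm list"
  | Neg "('f, 'p, 'v) fm"
  | Or "('f, 'p, 'v) fm" "('f, 'p, 'v) fm"

abbreviation And :: "('f, 'p, 'v) fm \<Rightarrow> ('f, 'p, 'v) fm \<Rightarrow> ('f, 'p, 'v) fm" where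
  "And \<phi> \<psi> \<equiv> Neg (Or (Neg \<phi>) (Neg \<psi>))"

abbreviation Imp :: "('f, 'p, 'v) fm \<Rightarrow> ('f, 'p, 'v) fm \<Rightarrow> ('f, 'p, 'v) fm" where
  "Imp \<phi> \<psi> \<equiv> Or (Neg \<phi>) \<psi>"

datatype ('f, 'p, 'v) prenex =
    Matrix "('f, 'p, 'v) fm"
  | Forall "'v var" "('f, 'p, 'v) prenex"
  | Exists "'v var" "('f, 'p, 'v) prenex"

abbreviation Foralls :: "'v var list \<Rightarrow> ('f, 'p, 'v) prenex \<Rightarrow> ('f, 'p, 'v) prenex" where
  "Foralls xs q \<equiv> foldr Forall xs q"


datatype ('f, 'p, 'v) symbol = SVar "'v var" | SFun 'f nat | SPred 'p nat

primrec symb_trm :: "('f, 'v) trm \<Rightarrow> ('f, 'p, 'v) symbol set" where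
  "symb_trm (Var x) = {SVar (DVar x)}"
| "symb_trm (Fun f ts) = insert (SFun f (length ts)) (\<Union> (set (map symb_trm ts)))"

primrec Symb :: "('f, 'p, 'v) fm \<Rightarrow> ('f, 'p, 'v) symbol set" where
  "Symb Top = {}"
| "Symb Bot = {}"
| "Symb (BoolVar x) = {SVar (BVar x)}"
| "Symb (Eq s t) = symb_trm s \<union> symb_trm t"
| "Symb (Pred p ts) = insert (SPred p (length ts)) (\<Union> (set (map symb_trm ts)))"
| "Symb (Neg \<phi>) = Symb \<phi>"
| "Symb (Or \<phi> \<psi>) = Symb \<phi> \<union> Symb \<psi>"

definition Vars :: "('f, 'p, 'v) fm \<Rightarrow> 'v var set" where
  "Vars \<phi> = {x. SVar x \<in> Symb \<phi>}"

definition preceq :: "('f, 'p, 'v) fm \<Rightarrow> ('f, 'p, 'v) fm \<Rightarrow> bool" (infix "\<preceq>" 50) where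
  "\<phi> \<preceq> \<psi> \<longleftrightarrow> Symb \<phi> \<subseteq> Symb \<psi>"


record ('f, 'p, 'u) interp =
  univ :: "'u set"
  func :: "'f \<Rightarrow> 'u list \<Rightarrow> 'u"
  pred :: "'p \<Rightarrow> 'u list \<Rightarrow> bool"

definition is_interp :: "('f, 'p, 'u) interp \<Rightarrow> bool" where
  "is_interp M \<longleftrightarrow> univ M \<noteq> {} \<and> (\<forall>f us. set us \<subseteq> univ M \<longrightarrow> func M f us \<in> univ M)"

primrec eval_trm :: "('f, 'p, 'u) interp \<Rightarrow> ('v \<Rightarrow> 'u) \<Rightarrow> ('f, 'v) trm \<Rightarrow> 'u" where
  "eval_trm M a (Var x) = a x"
| "eval_trm M a (Fun f ts) = func M f (map (eval_trm M a) ts)"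

primrec holds :: "('f, 'p, 'u) interp \<Rightarrow> ('v \<Rightarrow> 'u) \<Rightarrow> ('v \<Rightarrow> bool) \<Rightarrow> ('f, 'p, 'v) fm \<Rightarrow> bool" where
  "holds M a b Top \<longleftrightarrow> True"
| "holds M a b Bot \<longleftrightarrow> False"
| "holds M a b (BoolVar x) \<longleftrightarrow> b x"
| "holds M a b (Eq s t) \<longleftrightarrow> eval_trm M a s = eval_trm M a t"
| "holds M a b (Pred p ts) \<longleftrightarrow> pred M p (map (eval_trm M a) ts)"
| "holds M a b (Neg \<phi>) \<longleftrightarrow> \<not> holds M a b \<phi>"
| "holds M a b (Or \<phi> \<psi>) \<longleftrightarrow> holds M a b \<phi> \<or> holds M a b \<psi>"

primrec holds_prenex ::
  "('f, 'p, 'u) interp \<Rightarrow> ('v \<Rightarrow> 'u) \<Rightarrow> ('v \<Rightarrow> bool) \<Rightarrow> ('f, 'p, 'v) prenex \<Rightarrow> bool" where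
  "holds_prenex M a b (Matrix \<phi>) \<longleftrightarrow> holds M a b \<phi>"
| "holds_prenex M a b (Forall x q) \<longleftrightarrow>
     (case x of
        DVar v \<Rightarrow> \<forall>d\<in>univ M. holds_prenex M (a(v := d)) b q
      | BVar v \<Rightarrow> \<forall>t. holds_prenex M a (b(v := t)) q)"
| "holds_prenex M a b (Exists x q) \<longleftrightarrow>
     (case x of
        DVar v \<Rightarrow> \<exists>d\<in>univ M. holds_prenex M (a(v := d)) b q
      | BVar v \<Rightarrow> \<exists>t. holds_prenex M a (b(v := t)) q)"

text \<open>
  Validity and satisfiability range over all structures whose domain is a nonempty set of
  elements of the type \<open>'u\<close>. HOL cannot quantify over all types inside a definition, so \<open>'u\<close>
  is an explicit parameter; a theorem in which it is left free speaks about domains of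
  arbitrary size.
\<close>

definition valid :: "'u itself \<Rightarrow> ('f, 'p, 'v) prenex \<Rightarrow> bool" where
  "valid U q \<longleftrightarrow> (\<forall>(M :: ('f, 'p, 'u) interp) a b.
     is_interp M \<longrightarrow> range a \<subseteq> univ M \<longrightarrow> holds_prenex M a b q)"

definition satisfiable :: "'u itself \<Rightarrow> ('f, 'p, 'v) fm \<Rightarrow> bool" where
  "satisfiable U \<phi> \<longleftrightarrow> (\<exists>(M :: ('f, 'p, 'u) interp) a b.
     is_interp M \<and> range a \<subseteq> univ M \<and> holds M a b \<phi>)"


text \<open>Renamings are only used with maps \<open>r\<close> that preserve the sort of each variable.\<close>

primrec rename_trm :: "('v var \<Rightarrow> 'v var) \<Rightarrow> ('f, 'v) trm \<Rightarrow> ('f, 'v) trm" where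
  "rename_trm r (Var x) = Var (name (r (DVar x)))"
| "rename_trm r (Fun f ts) = Fun f (map (rename_trm r) ts)"

primrec rename :: "('v var \<Rightarrow> 'v var) \<Rightarrow> ('f, 'p, 'v) fm \<Rightarrow> ('f, 'p, 'v) fm" where
  "rename r Top = Top"
| "rename r Bot = Bot"
| "rename r (BoolVar x) = BoolVar (name (r (BVar x)))"
| "rename r (Eq s t) = Eq (rename_trm r s) (rename_trm r t)"
| "rename r (Pred p ts) = Pred p (map (rename_trm r) ts)"
| "rename r (Neg \<phi>) = Neg (rename r \<phi>)"
| "rename r (Or \<phi> \<psi>) = Or (rename r \<phi>) (rename r \<psi>)"

definition replace_vars :: "'v var list \<Rightarrow> 'v var list \<Rightarrow> 'v var \<Rightarrow> 'v var" where
  "replace_vars xs ys x = (case map_of (zip xs ys) x of Some y \<Rightarrow> y | None \<Rightarrow> x)"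

primrec subst_bool :: "'v \<Rightarrow> ('f, 'p, 'v) fm \<Rightarrow> ('f, 'p, 'v) fm \<Rightarrow> ('f, 'p, 'v) fm" where
  "subst_bool c \<chi> Top = Top"
| "subst_bool c \<chi> Bot = Bot"
| "subst_bool c \<chi> (BoolVar x) = (if x = c then \<chi> else BoolVar x)"
| "subst_bool c \<chi> (Eq s t) = Eq s t"
| "subst_bool c \<chi> (Pred p ts) = Pred p ts"
| "subst_bool c \<chi> (Neg \<phi>) = Neg (subst_bool c \<chi> \<phi>)"
| "subst_bool c \<chi> (Or \<phi> \<psi>) = Or (subst_bool c \<chi> \<phi>) (subst_bool c \<chi> \<psi>)"

definition fresh_copy :: "'v var set \<Rightarrow> 'v var list \<Rightarrow> 'v var list \<Rightarrow> bool" where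
  "fresh_copy X xs ys \<longleftrightarrow>
     list_all2 (\<lambda>x y. is_dom x = is_dom y) xs ys \<and> distinct ys \<and> set ys \<inter> X = {}"

definition craig_interpolant ::
  "'u itself \<Rightarrow> ('f, 'p, 'v) fm \<Rightarrow> ('f, 'p, 'v) fm \<Rightarrow> ('f, 'p, 'v) fm \<Rightarrow> bool" where
  "craig_interpolant U A B I \<longleftrightarrow>
     \<not> satisfiable U (And A B) \<and> I \<preceq> A \<and> I \<preceq> B \<and>
     valid U (Matrix (Imp A I)) \<and> valid U (Matrix (Imp B (Neg I)))"

end

theory Submission imports Defs begin

text \<open>
  Fix a structure and values of the variables, and let \<open>t\<close> be the truth value of \<open>I\<close>, which
  depends only on the values of the \<open>i\<close>-variables. If \<open>\<Phi>(i, t, o)\<close> were false, then giving the fresh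
  copy of \<open>o\<close> the value of \<open>o\<close> would make \<open>A\<close> true (if \<open>t\<close> is false) or \<open>B\<close> true (if \<open>t\<close> is true)
  without changing the \<open>i\<close>-variables, so \<open>A \<Rightarrow> I\<close> or \<open>B \<Rightarrow> \<not> I\<close> would be violated.
\<close>

section \<open>Renaming and substitution seen through assignments\<close>

text \<open>Precomposition with \<open>r\<close>, restricted to domain variables. Stripping the sort
  by \<open>name\<close> matches what \<open>rename_trm\<close> does, so truth transfers along any
  \<open>r\<close>.\<close>

definition pull_dom :: "('v var \<Rightarrow> 'v var) \<Rightarrow> ('v \<Rightarrow> 'u) \<Rightarrow> 'v \<Rightarrow> 'u" where
  "pull_dom r a x = a (name (r (DVar x)))"

definition pull_bool :: "('v var \<Rightarrow> 'v var) \<Rightarrow> ('v \<Rightarrow> bool) \<Rightarrow> 'v \<Rightarrow> bool" where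
  "pull_bool r b x = b (name (r (BVar x)))"

lemma range_pull_dom: "range a \<subseteq> S \<Longrightarrow> range (pull_dom r a) \<subseteq> S"
  by (auto simp: pull_dom_def)

lemma eval_trm_rename: "eval_trm M a (rename_trm r t) = eval_trm M (pull_dom r a) t"
  by (induction t) (simp_all add: pull_dom_def comp_def cong: map_cong)

lemma holds_rename:
  "holds M a b (rename r \<phi>) \<longleftrightarrow> holds M (pull_dom r a) (pull_bool r b) \<phi>"
  by (induction \<phi>) (simp_all add: eval_trm_rename pull_bool_def comp_def)

lemma holds_subst_bool:
  "holds M a b (subst_bool c \<chi> \<phi>) \<longleftrightarrow> holds M a (b(c := holds M a b \<chi>)) \<phi>"
  by (induction \<phi>) auto

lemma eval_trm_cong:
  fixes t :: "('f, 'v) trm"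
  assumes "\<And>x. (SVar (DVar x) :: ('f, 'p, 'v) symbol) \<in> symb_trm t \<Longrightarrow> a x = a' x"
  shows "eval_trm M a t = eval_trm M a' t"
  using assms
proof (induction t)
  case (Fun f ts)
  have "map (eval_trm M a) ts = map (eval_trm M a') ts"
    using Fun by (intro map_cong) auto
  then show ?case by (simp only: eval_trm.simps)
qed simp

lemma holds_cong:
  fixes \<phi> :: "('f, 'p, 'v) fm"
  assumes "\<And>x. DVar x \<in> Vars \<phi> \<Longrightarrow> a x = a' x" and "\<And>x. BVar x \<in> Vars \<phi> \<Longrightarrow> b x = b' x"
  shows "holds M a b \<phi> \<longleftrightarrow> holds M a' b' \<phi>"
  using assms
proof (induction \<phi>)
  case (Eq s t)
  then have "eval_trm M a s = eval_trm M a' s" "eval_trm M a t = eval_trm M a' t"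
    by (auto simp: Vars_def intro!: eval_trm_cong[where 'p = 'p])
  then show ?case by simp
next
  case (Pred p ts)
  have "map (eval_trm M a) ts = map (eval_trm M a') ts"
    using Pred by (intro map_cong) (auto simp: Vars_def intro!: eval_trm_cong[where 'p = 'p])
  then show ?case by (simp only: holds.simps)
qed (auto simp: Vars_def)

section \<open>Blocks of universal quantifiers\<close>

text \<open>Turns a block into a single quantification over assignments, so that later proofs can
  pass to a suitable assignment at once instead of instantiating variable by variable.\<close>

lemma holds_Foralls_iff:
  assumes "range a \<subseteq> univ M"
  shows "holds_prenex M a b (Foralls xs q) \<longleftrightarrow>
    (\<forall>a' b'. range a' \<subseteq> univ M \<longrightarrow> (\<forall>x. DVar x \<notin> set xs \<longrightarrow> a' x = a x) \<longrightarrow>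
       (\<forall>x. BVar x \<notin> set xs \<longrightarrow> b' x = b x) \<longrightarrow> holds_prenex M a' b' q)"
  using assms
proof (induction xs arbitrary: a b)
  case Nil
  show ?case
  proof
    assume "holds_prenex M a b (Foralls [] q)"
    then show "\<forall>a' b'. range a' \<subseteq> univ M \<longrightarrow> (\<forall>x. DVar x \<notin> set [] \<longrightarrow> a' x = a x) \<longrightarrow>
       (\<forall>x. BVar x \<notin> set [] \<longrightarrow> b' x = b x) \<longrightarrow> holds_prenex M a' b' q"
      by (auto simp flip: fun_eq_iff)
  qed (use Nil in auto)
next
  case (Cons y ys)
  show ?case
  proof (cases y)
    case (DVar v)
    have "range (a(v := d)) \<subseteq> univ M" if "d \<in> univ M" for d
      using Cons.prems that by auto
    note IH = Cons.IH[OF this]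
    show ?thesis (is "?L \<longleftrightarrow> ?R")
    proof
      assume L: ?L
      show ?R
      proof (intro allI impI)
        fix a' b'
        assume *: "range a' \<subseteq> univ M" "\<forall>x. DVar x \<notin> set (y # ys) \<longrightarrow> a' x = a x"
          "\<forall>x. BVar x \<notin> set (y # ys) \<longrightarrow> b' x = b x"
        then have "a' v \<in> univ M" by auto
        \<comment> \<open>The head quantifier takes the value that \<open>a'\<close> itself gives to
          \<open>v\<close>; then \<open>a'\<close> differs from the updated assignment on
          \<open>ys\<close> only, as the induction hypothesis requires.\<close>
        moreover from this L have "holds_prenex M (a(v := a' v)) b (Foralls ys q)"
          by (simp add: DVar)
        ultimately show "holds_prenex M a' b' q"
          using * by (auto simp: IH DVar)
      qed
    next
      assume R: ?R
      show ?L
        using R by (auto simp: DVar IH)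
    qed
  next
    case (BVar v)
    show ?thesis (is "?L \<longleftrightarrow> ?R")
    proof
      assume L: ?L
      show ?R
      proof (intro allI impI)
        fix a' b'
        assume *: "range a' \<subseteq> univ M" "\<forall>x. DVar x \<notin> set (y # ys) \<longrightarrow> a' x = a x"
          "\<forall>x. BVar x \<notin> set (y # ys) \<longrightarrow> b' x = b x"
        from L have "holds_prenex M a (b(v := b' v)) (Foralls ys q)"
          by (simp add: BVar)
        then show "holds_prenex M a' b' q"
          using * by (auto simp: Cons.IH[OF Cons.prems] BVar)
      qed
    next
      assume R: ?R
      show ?L
        using R by (auto simp: BVar Cons.IH[OF Cons.prems])
    qed
  qed
qed

section \<open>Variables of renamed and substituted formulas\<close>

lemma Vars_subst_bool: "Vars (subst_bool c \<chi> \<phi>) \<subseteq> Vars \<chi> \<union> Vars \<phi>"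
  unfolding Vars_def by (induction \<phi>) auto

text \<open>Renaming rewraps the bare name as a domain variable, and this gives back
  \<open>r (DVar v)\<close> because \<open>r\<close> keeps sorts.\<close>

lemma vars_rename_trm:
  fixes t :: "('f, 'v) trm"
  assumes "\<And>x. is_dom (r x) = is_dom x" and "(SVar x :: ('f, 'p, 'v) symbol) \<in> symb_trm (rename_trm r t)"
  shows "\<exists>y. (SVar y :: ('f, 'p, 'v) symbol) \<in> symb_trm t \<and> x = r y"
  using assms(2)
proof (induction t)
  case (Var v)
  then show ?case using assms(1)[of "DVar v"] by (cases "r (DVar v)") auto
next
  case (Fun f ts)
  then obtain t where "t \<in> set ts" "(SVar x :: ('f, 'p, 'v) symbol) \<in> symb_trm (rename_trm r t)"
    by auto
  with Fun.IH show ?case by fastforce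
qed

lemma Vars_rename:
  assumes "\<And>x. is_dom (r x) = is_dom x"
  shows "Vars (rename r \<phi>) \<subseteq> r ` Vars \<phi>"
proof (induction \<phi>)
  case (BoolVar v)
  then show ?case using assms[of "BVar v"] by (cases "r (BVar v)") (auto simp: Vars_def)
next
  case (Eq s t)
  then show ?case
    using vars_rename_trm[of r, OF assms] unfolding Vars_def by fastforce
next
  case (Pred p ts)
  then show ?case
    using vars_rename_trm[of r, OF assms] unfolding Vars_def by fastforce
qed (auto simp: Vars_def)

lemma replace_vars_notin: "x \<notin> set xs \<Longrightarrow> replace_vars xs ys x = x"
  by (auto simp: replace_vars_def dest!: map_of_SomeD set_zip_leftD split: option.split)

lemma replace_vars_nth:
  assumes "distinct xs" "length xs = length ys" "k < length xs"
  shows "replace_vars xs ys (xs ! k) = ys ! k"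
  using assms by (simp add: replace_vars_def map_of_zip_nth)

lemma is_dom_replace_vars:
  assumes "list_all2 (\<lambda>x y. is_dom x = is_dom y) xs ys"
  shows "is_dom (replace_vars xs ys x) = is_dom x"
  using assms
  by (auto simp: replace_vars_def list_all2_iff split: option.split dest!: map_of_SomeD)

lemma pull_dom_replace_vars_notin:
  assumes "DVar x \<notin> set xs"
  shows "pull_dom (replace_vars xs ys) a x = a x"
  using assms by (simp add: pull_dom_def replace_vars_notin)

lemma pull_bool_replace_vars_notin:
  assumes "BVar x \<notin> set xs"
  shows "pull_bool (replace_vars xs ys) b x = b x"
  using assms by (simp add: pull_bool_def replace_vars_notin)

section \<open>Fresh copies\<close>

text \<open>Used to bound the variables of \<open>A\<close> and \<open>B\<close>, with
  \<open>Z\<close> consisting of the \<open>i\<close>-variables and \<open>c\<close>.\<close>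

lemma Vars_rename_fresh_copy:
  assumes "fresh_copy X xs ys" "distinct xs" "Vars \<chi> = {}"
    and "Vars \<phi> \<subseteq> Z \<union> set xs"
  shows "Vars (Neg (subst_bool c \<chi> (rename (replace_vars xs ys) \<phi>))) \<subseteq> Z \<union> set ys"
proof -
  have ys: "list_all2 (\<lambda>x y. is_dom x = is_dom y) xs ys"
    using assms(1) by (simp add: fresh_copy_def)
  have "replace_vars xs ys x \<in> Z \<union> set ys" if "x \<in> Z \<union> set xs" for x
  proof (cases "x \<in> set xs")
    case True
    then show ?thesis
      using list_all2_lengthD[OF ys] assms(2)
      by (auto simp: in_set_conv_nth[of x] replace_vars_nth)
  qed (use that in \<open>auto simp: replace_vars_notin\<close>)
  then show ?thesis
    using Vars_rename[of "replace_vars xs ys" \<phi>, OF is_dom_replace_vars[OF ys]] assms(3,4)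
      Vars_subst_bool[of c \<chi> "rename (replace_vars xs ys) \<phi>"]
    unfolding Vars_def by fastforce
qed

text \<open>The assignment on the left gives every copy in \<open>ys\<close> the value of its
  original. Reading the renamed formula there undoes the renaming, since the two replacements
  compose to the identity on \<open>X\<close>.\<close>

lemma holds_rename_fresh_copy:
  assumes copy: "fresh_copy X xs ys" and "distinct xs" and "Vars \<phi> \<subseteq> X"
    and "BVar c \<in> X" "BVar c \<notin> set xs"
  shows "holds M (pull_dom (replace_vars ys xs) a) ((pull_bool (replace_vars ys xs) b)(c := t))
      (rename (replace_vars xs ys) \<phi>) \<longleftrightarrow> holds M a (b(c := t)) \<phi>"
proof -
  let ?r = "replace_vars xs ys" and ?s = "replace_vars ys xs"
  have sorts: "list_all2 (\<lambda>x y. is_dom x = is_dom y) xs ys"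
    and "distinct ys" and disj: "set ys \<inter> X = {}"
    using copy by (auto simp: fresh_copy_def)
  note len = list_all2_lengthD[OF sorts]
  \<comment> \<open>The second conjunct ensures that the update at \<open>c\<close>, made after
    pulling back along \<open>?s\<close>, touches no renamed variable other than
    \<open>c\<close>.\<close>
  have inv: "?s (?r x) = x \<and> (x \<noteq> BVar c \<longrightarrow> ?r x \<noteq> BVar c)" if "x \<in> X" for x
  proof (cases "x \<in> set xs")
    case True
    then obtain k where "k < length xs" "x = xs ! k" by (auto simp: in_set_conv_nth)
    moreover from this have "ys ! k \<noteq> BVar c"
      using len disj \<open>BVar c \<in> X\<close> by (metis disjoint_iff nth_mem)
    ultimately show ?thesis
      using len \<open>distinct xs\<close> \<open>distinct ys\<close> by (simp add: replace_vars_nth)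
  next
    case False
    moreover have "x \<notin> set ys" using that disj by blast
    ultimately show ?thesis by (simp add: replace_vars_notin)
  qed
  have D: "DVar (name (?r (DVar x))) = ?r (DVar x)" for x
    using is_dom_replace_vars[OF sorts, of "DVar x"] by (cases "?r (DVar x)") auto
  have B: "BVar (name (?r (BVar x))) = ?r (BVar x)" for x
    using is_dom_replace_vars[OF sorts, of "BVar x"] by (cases "?r (BVar x)") auto
  have c: "?r (BVar c) = BVar c"
    using assms(5) by (simp add: replace_vars_notin)
  show ?thesis
    unfolding holds_rename
  proof (rule holds_cong)
    fix x assume "DVar x \<in> Vars \<phi>"
    then show "pull_dom ?r (pull_dom ?s a) x = a x"
      using inv[of "DVar x"] assms(3) by (auto simp: pull_dom_def D)
  next
    fix x assume "BVar x \<in> Vars \<phi>"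
    then have x: "BVar x \<in> X" using assms(3) by auto
    show "pull_bool ?r ((pull_bool ?s b)(c := t)) x = (b(c := t)) x"
    proof (cases "x = c")
      case False
      then have "name (?r (BVar x)) \<noteq> c"
        using inv[OF x] B[of x] by auto
      then show ?thesis
        using False inv[OF x] by (simp add: pull_bool_def B)
    qed (simp add: pull_bool_def c)
  qed
qed

theorem theorem1:
  fixes \<Phi> :: "('f, 'p, 'v) fm"
    and i_vars o_vars o_bot o_top :: "'v var list"
    and c :: 'v
    and A B :: "('f, 'p, 'v) fm"
  assumes "distinct (i_vars @ BVar c # o_vars)"
    and "Vars \<Phi> \<subseteq> set (i_vars @ BVar c # o_vars)"
    and "valid TYPE('u) (Foralls i_vars (Exists (BVar c) (Foralls o_vars (Matrix \<Phi>))))"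
    and "fresh_copy (set (i_vars @ BVar c # o_vars)) o_vars o_bot"
    and "fresh_copy (set (i_vars @ BVar c # o_vars)) o_vars o_top"
    and "set o_bot \<inter> set o_top = {}"
    and "A = Neg (subst_bool c Bot (rename (replace_vars o_vars o_bot) \<Phi>))"
    and "B = Neg (subst_bool c Top (rename (replace_vars o_vars o_top) \<Phi>))"
  shows "\<not> satisfiable TYPE('u) (And A B) \<and>
    (\<forall>I. craig_interpolant TYPE('u) A B I \<longrightarrow>
       valid TYPE('u) (Foralls i_vars (Foralls o_vars (Matrix (subst_bool c I \<Phi>)))))"
proof (intro conjI allI impI)
  let ?X = "set (i_vars @ BVar c # o_vars)"
  have dist: "distinct o_vars" and c: "BVar c \<in> ?X" "BVar c \<notin> set o_vars"
    using assms(1) by auto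
  show "\<not> satisfiable TYPE('u) (And A B)"
  proof
    assume "satisfiable TYPE('u) (And A B)"
    then obtain M :: "('f, 'p, 'u) interp" and a b
      where M: "is_interp M" and a: "range a \<subseteq> univ M" and AB: "holds M a b A" "holds M a b B"
      by (auto simp: satisfiable_def)
    \<comment> \<open>The outer block is instantiated at the given assignment itself.\<close>
    have "holds_prenex M a b (Exists (BVar c) (Foralls o_vars (Matrix \<Phi>)))"
      using assms(3) M a holds_Foralls_iff[OF a] unfolding valid_def by blast
    then obtain t where t: "holds_prenex M a (b(c := t)) (Foralls o_vars (Matrix \<Phi>))"
      by auto
    \<comment> \<open>One value \<open>t\<close> serves both copies: pulling back along the renaming
      changes values on \<open>o_vars\<close> only, and the inner block covers all of these. If
      \<open>t\<close> is false this contradicts \<open>A\<close>, otherwise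
      \<open>B\<close>.\<close>
    have "holds M a (b(c := t)) (rename (replace_vars o_vars ys) \<Phi>)" for ys
      using t range_pull_dom[OF a] unfolding holds_rename holds_Foralls_iff[OF a]
      by (simp add: pull_dom_replace_vars_notin pull_bool_replace_vars_notin del: fun_upd_apply)
    then show False
      using AB by (cases t) (auto simp: assms(7,8) holds_subst_bool)
  qed
  fix I
  assume "craig_interpolant TYPE('u) A B I"
  then have IAB: "Vars I \<subseteq> Vars A" "Vars I \<subseteq> Vars B"
    and AI: "valid TYPE('u) (Matrix (Imp A I))"
    and BI: "valid TYPE('u) (Matrix (Imp B (Neg I)))"
    by (auto simp: craig_interpolant_def preceq_def Vars_def)
  have Vars_\<Phi>: "Vars \<Phi> \<subseteq> set (i_vars @ [BVar c]) \<union> set o_vars"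
    using assms(2) by auto
  have "Vars A \<subseteq> set (i_vars @ [BVar c]) \<union> set o_bot"
    unfolding assms(7)
    by (rule Vars_rename_fresh_copy[OF assms(4) dist _ Vars_\<Phi>]) (simp add: Vars_def)
  moreover have "Vars B \<subseteq> set (i_vars @ [BVar c]) \<union> set o_top"
    unfolding assms(8)
    by (rule Vars_rename_fresh_copy[OF assms(5) dist _ Vars_\<Phi>]) (simp add: Vars_def)
  \<comment> \<open>A variable of \<open>I\<close> outside \<open>i_vars\<close> and
    \<open>c\<close> would lie in both \<open>o_bot\<close> and \<open>o_top\<close>, which are
    disjoint.\<close>
  ultimately have Vars_I: "Vars I \<subseteq> ?X"
    using IAB assms(6) unfolding set_append by simp blast
  have main: "holds M a b (subst_bool c I \<Phi>)"
    if M: "is_interp M" and a: "range a \<subseteq> univ M" for M :: "('f, 'p, 'u) interp" and a b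
  proof -
    \<comment> \<open>Overwriting the copies leaves \<open>I\<close> unchanged, because its
      variables lie in \<open>?X\<close> and the copies avoid \<open>?X\<close>.\<close>
    have I_copy: "holds M (pull_dom (replace_vars ys o_vars) a) (pull_bool (replace_vars ys o_vars) b) I
        \<longleftrightarrow> holds M a b I" if "fresh_copy ?X o_vars ys" for ys
    proof (rule holds_cong)
      have "set ys \<inter> ?X = {}"
        using that by (simp add: fresh_copy_def)
      then show "pull_dom (replace_vars ys o_vars) a x = a x" if "DVar x \<in> Vars I" for x
        using that Vars_I by (intro pull_dom_replace_vars_notin) blast
      show "pull_bool (replace_vars ys o_vars) b x = b x" if "BVar x \<in> Vars I" for x
        using that Vars_I \<open>set ys \<inter> ?X = {}\<close> by (intro pull_bool_replace_vars_notin) blast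
    qed
    note \<Phi>_copy = holds_rename_fresh_copy[OF _ dist assms(2) c]
    show ?thesis
    \<comment> \<open>By \<open>holds_subst_bool\<close>, the goal is \<open>\<Phi>\<close> with
      \<open>c\<close> set to the truth value of \<open>I\<close>. The case split makes this value
      the constant substituted in \<open>B\<close> or in \<open>A\<close>; falsity of that formula
      at the copied values is the goal.\<close>
    proof (cases "holds M a b I")
      case True
      let ?s = "replace_vars o_top o_vars"
      have "\<not> holds M (pull_dom ?s a) (pull_bool ?s b) B"
        using BI M range_pull_dom[OF a] I_copy[OF assms(5)] True by (auto simp: valid_def)
      then show ?thesis
        using True by (simp add: assms(8) holds_subst_bool \<Phi>_copy[OF assms(5)])
    next
      case False
      let ?s = "replace_vars o_bot o_vars"
      have "\<not> holds M (pull_dom ?s a) (pull_bool ?s b) A"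
        using AI M range_pull_dom[OF a] I_copy[OF assms(4)] False by (auto simp: valid_def)
      then show ?thesis
        using False by (simp add: assms(7) holds_subst_bool \<Phi>_copy[OF assms(4)])
    qed
  qed
  show "valid TYPE('u) (Foralls i_vars (Foralls o_vars (Matrix (subst_bool c I \<Phi>))))"
    using main by (simp add: valid_def holds_Foralls_iff)
qed

end
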